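(* Let $(M,\varphi,\xi,\eta,g)$ be an almost contact B-metric manifold in the class $\mathcal{F}_3\oplus\mathcal{F}_7$. The torsion $\ddot{T}$ of the $\varphi$KT-connection on $(M,\varphi,\xi,\eta,g)$ belongs to $\mathcal{T}_{3}\oplus\mathcal{T}_{6}\oplus\mathcal{T}_{7}\oplus\mathcal{T}_{12}$ (at every point of $M$).
   Context: An almost contact B-metric manifold $(M,\varphi,\xi,\eta,g)$ is a $(2n+1)$-dimensional smooth manifold with an endomorphism $\varphi$ of the tangent bundle, a vector field $\xi$, a 1-form $\eta$ and a pseudo-Riemannian metric $g$ of signature $(n,n+1)$ (so $g(\xi,\xi)=1$ and $g|_{\ker\eta}$ has signature $(n,n)$) such that $\varphi\xi=0$, $\varphi^2=-\mathrm{Id}+\eta\otimes\xi$, $\eta\circ\varphi=0$, $\eta(\xi)=1$, $g(\varphi X,\varphi Y)=-g(X,Y)+\eta(X)\eta(Y)$. $\nabla$ is the Levi-Civita connection of $g$, and $F(x,y,z)=g((\nabla_x\varphi)y,z)$, which satisfies $F(x,y,z)=F(x,z,y)=F(x,\varphi y,\varphi z)+\eta(y)F(x,\xi,z)+\eta(z)F(x,y,\xi)$. $\mathop{\mathfrak{S}}_{x,y,z}$ denotes the cyclic sum. Classes (conditions on a $(0,3)$-tensor $F$ satisfying $F(x,y,z)=F(x,z,y)=F(x,\varphi y,\varphi z)+\eta(y)F(x,\xi,z)+\eta(z)F(x,y,\xi)$): $\mathcal{F}_3$: $F(\xi,y,z)=F(x,\xi,z)=0$ and $\mathop{\mathfrak{S}}_{x,y,z}F(x,y,z)=0$.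 $\mathcal{F}_7$: $F(x,y,z)=F(x,y,\xi)\eta(z)+F(x,z,\xi)\eta(y)$, $F(x,y,\xi)=-F(y,x,\xi)=-F(\varphi x,\varphi y,\xi)$, and $\theta=\theta^*=0$, where $\theta(z)=g^{ij}F(e_i,e_j,z)$, $\theta^*(z)=g^{ij}F(e_i,\varphi e_j,z)$, $\{e_i\}_{i=1}^{2n}$ a basis of $\ker\eta$, $(g^{ij})$ the inverse of $(g(e_i,e_j))$. $M\in\mathcal{F}_3\oplus\mathcal{F}_7$ means that at each point $F$ is a sum of a tensor satisfying the $\mathcal{F}_3$ conditions and one satisfying the $\mathcal{F}_7$ conditions. A natural connection is a linear connection $D$ with $D\varphi=D\xi=D\eta=Dg=0$. The $\varphi$KT-connection $\ddot D$ on $M\in\mathcal{F}_3\oplus\mathcal{F}_7$ is the natural connection with totally skew-symmetric torsion (i.e. a 3-form) determined by $g(\ddot D_xy,z)=g(\nabla_xy,z)+\frac12\ddot T(x,y,z)$, where its torsion tensor is $\ddot T(x,y,z)=-\frac12\mathop{\mathfrak{S}}_{x,y,z}\{F(x,y,\varphi z)-3\eta(x)F(y,\varphi z,\xi)\}$. At each point, among $(0,3)$-tensors $T$ on $T_pM$ with $T(x,y,z)=-T(y,x,z)$, one defines the subspaces (conditions for all $x,y,z$): $\mathcal{T}_3$: $T(\xi,y,z)=T(x,y,\xi)=0$, $T(x,y,z)=-T(\varphi x,\varphi y,z)=T(\varphi x,y,\varphi z)$; $\mathcal{T}_6$: $T(\xi,y,z)=T(x,y,\xi)=0$, $T(x,y,z)-T(\varphi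 x,\varphi y,z)=\mathop{\mathfrak{S}}_{x,y,z}T(\varphi x,y,z)=0$; $\mathcal{T}_7$: $T(x,y,z)=\eta(z)T(\varphi^2x,\varphi^2y,\xi)$, $T(x,y,\xi)=-T(\varphi x,\varphi y,\xi)$; $\mathcal{T}_{12}$: $T(x,y,z)=\eta(x)T(\xi,\varphi^2y,\varphi^2z)-\eta(y)T(\xi,\varphi^2x,\varphi^2z)$, $T(\xi,y,z)=-T(\xi,z,y)=-T(\xi,\varphi y,\varphi z)$. *)

theory Defs
  imports "HOL-Analysis.Analysis" "HOL-Library.Function_Algebras"
begin

instantiation "fun" :: (type, real_vector) real_vector
begin

definition scaleR_fun :: "real \<Rightarrow> ('a \<Rightarrow> 'b) \<Rightarrow> 'a \<Rightarrow> 'b" where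
  "scaleR_fun a f = (\<lambda>x. a *\<^sub>R f x)"

instance
  by standard (simp_all add: scaleR_fun_def plus_fun_def algebra_simps)

end


section \<open>Smooth manifolds\<close>

text \<open>\<open>C_k k S f\<close> is meant for open \<open>S\<close>. Since the spaces are finite-dimensional, requiring every
  directional derivative \<open>\<lambda>x. f' x v\<close> to be of class \<open>C\<^sup>k\<close> is the same as requiring \<open>f'\<close> to be.\<close>

primrec C_k :: "nat \<Rightarrow> 'a::euclidean_space set \<Rightarrow> ('a \<Rightarrow> 'b::euclidean_space) \<Rightarrow> bool" where
  "C_k 0 S f \<longleftrightarrow> continuous_on S f"
| "C_k (Suc k) S f \<longleftrightarrow>
     (\<exists>f'. (\<forall>x\<in>S. (f has_derivative f' x) (at x)) \<and> (\<forall>v. C_k k S (\<lambda>x. f' x v)))"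

definition smooth_on :: "'a::euclidean_space set \<Rightarrow> ('a \<Rightarrow> 'b::euclidean_space) \<Rightarrow> bool" where
  "smooth_on S f \<longleftrightarrow> (\<forall>k. C_k k S f)"

text \<open>The manifold is the whole type \<open>'m\<close>; a chart is a pair of its domain and its coordinate map.
  The values of the coordinate map outside the domain are irrelevant.\<close>

type_synonym ('m, 'e) atlas = "('m set \<times> ('m \<Rightarrow> 'e)) set"

definition smooth_manifold ::
  "('m::{t2_space,second_countable_topology}, 'e::euclidean_space) atlas \<Rightarrow> nat \<Rightarrow> bool" where
  "smooth_manifold \<A> m \<longleftrightarrow>
     DIM('e) = m \<and>
     (\<forall>(U, c)\<in>\<A>. open U \<and> open (c ` U) \<and> homeomorphism U (c ` U) c (inv_into U c)) \<and>
     (\<Union>(U, c)\<in>\<A>. U) = UNIV \<and>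
     (\<forall>(U, c)\<in>\<A>. \<forall>(V, d)\<in>\<A>. smooth_on (c ` (U \<inter> V)) (d \<circ> inv_into U c))"

definition smooth_fun :: "('m, 'e::euclidean_space) atlas \<Rightarrow> ('m \<Rightarrow> real) \<Rightarrow> bool" where
  "smooth_fun \<A> f \<longleftrightarrow> (\<forall>(U, c)\<in>\<A>. smooth_on (c ` U) (f \<circ> inv_into U c))"

text \<open>Tangent vectors at \<open>p\<close> are the derivations at \<open>p\<close> of the algebra of smooth functions on the
  manifold. They are extended by 0 to non-smooth functions, so that two derivations that agree on
  the smooth functions are equal.\<close>

type_synonym 'm tangent = "('m \<Rightarrow> real) \<Rightarrow> real"

definition tangent_space :: "('m, 'e::euclidean_space) atlas \<Rightarrow> 'm \<Rightarrow> 'm tangent set" where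
  "tangent_space \<A> p = {v.
     (\<forall>f h. smooth_fun \<A> f \<longrightarrow> smooth_fun \<A> h \<longrightarrow>
        v (\<lambda>q. f q + h q) = v f + v h \<and>
        v (\<lambda>q. f q * h q) = f p * v h + h p * v f) \<and>
     (\<forall>a f. smooth_fun \<A> f \<longrightarrow> v (\<lambda>q. a * f q) = a * v f) \<and>
     (\<forall>f. \<not> smooth_fun \<A> f \<longrightarrow> v f = 0)}"

type_synonym 'm vfield = "'m \<Rightarrow> 'm tangent"

definition vector_fields :: "('m, 'e::euclidean_space) atlas \<Rightarrow> 'm vfield set" where
  "vector_fields \<A> = {X. (\<forall>p. X p \<in> tangent_space \<A> p) \<and>
     (\<forall>f. smooth_fun \<A> f \<longrightarrow> smooth_fun \<A> (\<lambda>p. X p f))}"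

definition lie_bracket :: "'m vfield \<Rightarrow> 'm vfield \<Rightarrow> 'm vfield" where
  "lie_bracket X Y = (\<lambda>p f. X p (\<lambda>q. Y q f) - Y p (\<lambda>q. X q f))"


section \<open>Tensor fields and linear connections\<close>

definition linear_on :: "'a::real_vector set \<Rightarrow> ('a \<Rightarrow> 'b::real_vector) \<Rightarrow> bool" where
  "linear_on V f \<longleftrightarrow>
     (\<forall>x\<in>V. \<forall>y\<in>V. f (x + y) = f x + f y) \<and> (\<forall>a. \<forall>x\<in>V. f (a *\<^sub>R x) = a *\<^sub>R f x)"

definition bilinear_on :: "'a::real_vector set \<Rightarrow> ('a \<Rightarrow> 'a \<Rightarrow> real) \<Rightarrow> bool" where
  "bilinear_on V b \<longleftrightarrow> (\<forall>x\<in>V. linear_on V (b x) \<and> linear_on V (\<lambda>y. b y x))"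

definition trilinear_on :: "'a::real_vector set \<Rightarrow> ('a \<Rightarrow> 'a \<Rightarrow> 'a \<Rightarrow> real) \<Rightarrow> bool" where
  "trilinear_on V t \<longleftrightarrow> (\<forall>x\<in>V. \<forall>y\<in>V.
     linear_on V (\<lambda>z. t x y z) \<and> linear_on V (\<lambda>z. t x z y) \<and> linear_on V (\<lambda>z. t z x y))"

definition is_basis :: "'a::real_vector set \<Rightarrow> nat \<Rightarrow> (nat \<Rightarrow> 'a) \<Rightarrow> bool" where
  "is_basis V k e \<longleftrightarrow>
     inj_on e {..<k} \<and> independent (e ` {..<k}) \<and> span (e ` {..<k}) = V"

text \<open>\<open>r\<close> is the number of negative and \<open>s\<close> the number of positive signs.\<close>

definition has_signature :: "'a::real_vector set \<Rightarrow> ('a \<Rightarrow> 'a \<Rightarrow> real) \<Rightarrow> nat \<Rightarrow> nat \<Rightarrow> bool" where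
  "has_signature V b r s \<longleftrightarrow> (\<exists>e. is_basis V (r + s) e \<and>
     (\<forall>i<r + s. \<forall>j<r + s. b (e i) (e j) = (if i \<noteq> j then 0 else if i < r then - 1 else 1)))"

definition cyc :: "('a \<Rightarrow> 'a \<Rightarrow> 'a \<Rightarrow> real) \<Rightarrow> 'a \<Rightarrow> 'a \<Rightarrow> 'a \<Rightarrow> real" where
  "cyc S x y z = S x y z + S y z x + S z x y"

type_synonym 'm endo_field = "'m \<Rightarrow> 'm tangent \<Rightarrow> 'm tangent"
type_synonym 'm form_field = "'m \<Rightarrow> 'm tangent \<Rightarrow> real"
type_synonym 'm metric_field = "'m \<Rightarrow> 'm tangent \<Rightarrow> 'm tangent \<Rightarrow> real"
type_synonym 'm connection = "'m vfield \<Rightarrow> 'm vfield \<Rightarrow> 'm vfield"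

definition endo_app :: "'m endo_field \<Rightarrow> 'm vfield \<Rightarrow> 'm vfield" where
  "endo_app \<phi> X = (\<lambda>p. \<phi> p (X p))"

definition smooth_endomorphism :: "('m, 'e::euclidean_space) atlas \<Rightarrow> 'm endo_field \<Rightarrow> bool" where
  "smooth_endomorphism \<A> \<phi> \<longleftrightarrow>
     (\<forall>p. \<phi> p ` tangent_space \<A> p \<subseteq> tangent_space \<A> p \<and> linear_on (tangent_space \<A> p) (\<phi> p)) \<and>
     (\<forall>X\<in>vector_fields \<A>. endo_app \<phi> X \<in> vector_fields \<A>)"

definition smooth_one_form :: "('m, 'e::euclidean_space) atlas \<Rightarrow> 'm form_field \<Rightarrow> bool" where
  "smooth_one_form \<A> \<eta> \<longleftrightarrow>
     (\<forall>p. linear_on (tangent_space \<A> p) (\<eta> p)) \<and>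
     (\<forall>X\<in>vector_fields \<A>. smooth_fun \<A> (\<lambda>p. \<eta> p (X p)))"

definition pseudo_riemannian_metric ::
  "('m, 'e::euclidean_space) atlas \<Rightarrow> nat \<Rightarrow> nat \<Rightarrow> 'm metric_field \<Rightarrow> bool" where
  "pseudo_riemannian_metric \<A> r s g \<longleftrightarrow>
     (\<forall>p. bilinear_on (tangent_space \<A> p) (g p) \<and>
          (\<forall>x\<in>tangent_space \<A> p. \<forall>y\<in>tangent_space \<A> p. g p x y = g p y x) \<and>
          has_signature (tangent_space \<A> p) (g p) r s) \<and>
     (\<forall>X\<in>vector_fields \<A>. \<forall>Y\<in>vector_fields \<A>. smooth_fun \<A> (\<lambda>p. g p (X p) (Y p)))"

text \<open>A connection acts on smooth vector fields; its values elsewhere are irrelevant.\<close>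

definition linear_connection :: "('m, 'e::euclidean_space) atlas \<Rightarrow> 'm connection \<Rightarrow> bool" where
  "linear_connection \<A> D \<longleftrightarrow>
     (\<forall>X\<in>vector_fields \<A>. \<forall>Y\<in>vector_fields \<A>.
        D X Y \<in> vector_fields \<A> \<and>
        (\<forall>Z\<in>vector_fields \<A>. D (X + Y) Z = D X Z + D Y Z \<and> D Z (X + Y) = D Z X + D Z Y) \<and>
        (\<forall>f. smooth_fun \<A> f \<longrightarrow>
           D (\<lambda>p. f p *\<^sub>R X p) Y = (\<lambda>p. f p *\<^sub>R D X Y p) \<and>
           D X (\<lambda>p. f p *\<^sub>R Y p) = (\<lambda>p. X p f *\<^sub>R Y p + f p *\<^sub>R D X Y p)))"

definition torsion :: "'m connection \<Rightarrow> 'm vfield \<Rightarrow> 'm vfield \<Rightarrow> 'm vfield" where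
  "torsion D X Y = D X Y - D Y X - lie_bracket X Y"

definition lowered_torsion ::
  "'m metric_field \<Rightarrow> 'm connection \<Rightarrow> 'm vfield \<Rightarrow> 'm vfield \<Rightarrow> 'm vfield \<Rightarrow> 'm \<Rightarrow> real" where
  "lowered_torsion g D X Y Z p = g p (torsion D X Y p) (Z p)"

definition cov_endo :: "'m connection \<Rightarrow> 'm endo_field \<Rightarrow> 'm vfield \<Rightarrow> 'm vfield \<Rightarrow> 'm vfield" where
  "cov_endo D \<phi> X Y = D X (endo_app \<phi> Y) - endo_app \<phi> (D X Y)"

definition cov_form :: "'m connection \<Rightarrow> 'm form_field \<Rightarrow> 'm vfield \<Rightarrow> 'm vfield \<Rightarrow> 'm \<Rightarrow> real" where
  "cov_form D \<eta> X Y p = X p (\<lambda>q. \<eta> q (Y q)) - \<eta> p (D X Y p)"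

definition cov_metric ::
  "'m connection \<Rightarrow> 'm metric_field \<Rightarrow> 'm vfield \<Rightarrow> 'm vfield \<Rightarrow> 'm vfield \<Rightarrow> 'm \<Rightarrow> real" where
  "cov_metric D g X Y Z p =
     X p (\<lambda>q. g q (Y q) (Z q)) - g p (D X Y p) (Z p) - g p (Y p) (D X Z p)"

definition levi_civita ::
  "('m, 'e::euclidean_space) atlas \<Rightarrow> 'm metric_field \<Rightarrow> 'm connection \<Rightarrow> bool" where
  "levi_civita \<A> g D \<longleftrightarrow> linear_connection \<A> D \<and>
     (\<forall>X\<in>vector_fields \<A>. \<forall>Y\<in>vector_fields \<A>. torsion D X Y = 0 \<and>
        (\<forall>Z\<in>vector_fields \<A>. cov_metric D g X Y Z = 0))"

text \<open>A tensor field of type \<open>(0,3)\<close>, given as a function \<open>S\<close> of three smooth vector fields, has the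
  value \<open>t\<close> at the point \<open>p\<close>. Every tangent vector at \<open>p\<close> extends to a smooth vector field, hence
  \<open>t\<close> is unique on the tangent space; its values outside the tangent space are irrelevant.\<close>

definition tensor_at ::
  "('m, 'e::euclidean_space) atlas \<Rightarrow> ('m vfield \<Rightarrow> 'm vfield \<Rightarrow> 'm vfield \<Rightarrow> 'm \<Rightarrow> real) \<Rightarrow> 'm
     \<Rightarrow> ('m tangent \<Rightarrow> 'm tangent \<Rightarrow> 'm tangent \<Rightarrow> real) \<Rightarrow> bool" where
  "tensor_at \<A> S p t \<longleftrightarrow> trilinear_on (tangent_space \<A> p) t \<and>
     (\<forall>X\<in>vector_fields \<A>. \<forall>Y\<in>vector_fields \<A>. \<forall>Z\<in>vector_fields \<A>.
        S X Y Z p = t (X p) (Y p) (Z p))"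


section \<open>Almost contact B-metric manifolds\<close>

definition almost_contact_B_metric_manifold ::
  "('m::{t2_space,second_countable_topology}, 'e::euclidean_space) atlas \<Rightarrow> nat
     \<Rightarrow> 'm endo_field \<Rightarrow> 'm vfield \<Rightarrow> 'm form_field \<Rightarrow> 'm metric_field \<Rightarrow> bool" where
  "almost_contact_B_metric_manifold \<A> n \<phi> \<xi> \<eta> g \<longleftrightarrow>
     smooth_manifold \<A> (2 * n + 1) \<and>
     smooth_endomorphism \<A> \<phi> \<and>
     \<xi> \<in> vector_fields \<A> \<and>
     smooth_one_form \<A> \<eta> \<and>
     pseudo_riemannian_metric \<A> n (n + 1) g \<and>
     (\<forall>p. \<phi> p (\<xi> p) = 0 \<and> \<eta> p (\<xi> p) = 1 \<and>
        (\<forall>x\<in>tangent_space \<A> p.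
           \<phi> p (\<phi> p x) = - x + \<eta> p x *\<^sub>R \<xi> p \<and>
           \<eta> p (\<phi> p x) = 0 \<and>
           (\<forall>y\<in>tangent_space \<A> p. g p (\<phi> p x) (\<phi> p y) = - g p x y + \<eta> p x * \<eta> p y)))"

definition fundamental_F ::
  "'m endo_field \<Rightarrow> 'm metric_field \<Rightarrow> 'm connection
     \<Rightarrow> 'm vfield \<Rightarrow> 'm vfield \<Rightarrow> 'm vfield \<Rightarrow> 'm \<Rightarrow> real" where
  "fundamental_F \<phi> g nabla X Y Z p = g p (cov_endo nabla \<phi> X Y p) (Z p)"

text \<open>The following subspaces consist of tensors on a single tangent space \<open>V\<close> carrying the values
  \<open>\<phi>\<close>, \<open>\<xi>\<close>, \<open>\<eta>\<close>, \<open>g\<close> of the structure tensors at the point.\<close>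

definition F_tensors ::
  "'a::real_vector set \<Rightarrow> ('a \<Rightarrow> 'a) \<Rightarrow> 'a \<Rightarrow> ('a \<Rightarrow> real) \<Rightarrow> ('a \<Rightarrow> 'a \<Rightarrow> 'a \<Rightarrow> real) set" where
  "F_tensors V \<phi> \<xi> \<eta> = {F. trilinear_on V F \<and> (\<forall>x\<in>V. \<forall>y\<in>V. \<forall>z\<in>V.
     F x y z = F x z y \<and>
     F x y z = F x (\<phi> y) (\<phi> z) + \<eta> y * F x \<xi> z + \<eta> z * F x y \<xi>)}"

definition F3_class ::
  "'a::real_vector set \<Rightarrow> ('a \<Rightarrow> 'a) \<Rightarrow> 'a \<Rightarrow> ('a \<Rightarrow> real) \<Rightarrow> ('a \<Rightarrow> 'a \<Rightarrow> 'a \<Rightarrow> real) set" where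
  "F3_class V \<phi> \<xi> \<eta> = {F\<in>F_tensors V \<phi> \<xi> \<eta>. \<forall>x\<in>V. \<forall>y\<in>V. \<forall>z\<in>V.
     F \<xi> y z = 0 \<and> F x \<xi> z = 0 \<and> cyc F x y z = 0}"

text \<open>\<open>trace_12 h k e S\<close> is the sum of \<open>h\<^sup>i\<^sup>j S(e\<^sub>i, e\<^sub>j)\<close> over \<open>i, j < k\<close>.\<close>

definition trace_12 :: "(nat \<Rightarrow> nat \<Rightarrow> real) \<Rightarrow> nat \<Rightarrow> (nat \<Rightarrow> 'a) \<Rightarrow> ('a \<Rightarrow> 'a \<Rightarrow> real) \<Rightarrow> real" where
  "trace_12 h k e S = (\<Sum>i<k. \<Sum>j<k. h i j * S (e i) (e j))"

definition inverse_gram ::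
  "('a \<Rightarrow> 'a \<Rightarrow> real) \<Rightarrow> nat \<Rightarrow> (nat \<Rightarrow> 'a) \<Rightarrow> (nat \<Rightarrow> nat \<Rightarrow> real) \<Rightarrow> bool" where
  "inverse_gram g k e h \<longleftrightarrow>
     (\<forall>i<k. \<forall>j<k. (\<Sum>l<k. h i l * g (e l) (e j)) = (if i = j then 1 else 0))"

definition F7_class ::
  "'a::real_vector set \<Rightarrow> nat \<Rightarrow> ('a \<Rightarrow> 'a) \<Rightarrow> 'a \<Rightarrow> ('a \<Rightarrow> real) \<Rightarrow> ('a \<Rightarrow> 'a \<Rightarrow> real)
     \<Rightarrow> ('a \<Rightarrow> 'a \<Rightarrow> 'a \<Rightarrow> real) set" where
  "F7_class V n \<phi> \<xi> \<eta> g = {F\<in>F_tensors V \<phi> \<xi> \<eta>.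
     (\<forall>x\<in>V. \<forall>y\<in>V. \<forall>z\<in>V. F x y z = F x y \<xi> * \<eta> z + F x z \<xi> * \<eta> y) \<and>
     (\<forall>x\<in>V. \<forall>y\<in>V. F x y \<xi> = - F y x \<xi> \<and> F x y \<xi> = - F (\<phi> x) (\<phi> y) \<xi>) \<and>
     (\<forall>e h. is_basis {x\<in>V. \<eta> x = 0} (2 * n) e \<longrightarrow> inverse_gram g (2 * n) e h \<longrightarrow>
        (\<forall>z\<in>V. trace_12 h (2 * n) e (\<lambda>x y. F x y z) = 0 \<and>
                trace_12 h (2 * n) e (\<lambda>x y. F x (\<phi> y) z) = 0))}"

definition in_class_F3_F7 ::
  "('m, 'e::euclidean_space) atlas \<Rightarrow> nat \<Rightarrow> 'm endo_field \<Rightarrow> 'm vfield \<Rightarrow> 'm form_field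
     \<Rightarrow> 'm metric_field \<Rightarrow> 'm connection \<Rightarrow> bool" where
  "in_class_F3_F7 \<A> n \<phi> \<xi> \<eta> g nabla \<longleftrightarrow>
     (\<forall>p. \<exists>F\<^sub>3\<in>F3_class (tangent_space \<A> p) (\<phi> p) (\<xi> p) (\<eta> p).
          \<exists>F\<^sub>7\<in>F7_class (tangent_space \<A> p) n (\<phi> p) (\<xi> p) (\<eta> p) (g p).
            tensor_at \<A> (fundamental_F \<phi> g nabla) p (\<lambda>x y z. F\<^sub>3 x y z + F\<^sub>7 x y z))"


section \<open>The \<open>\<phi>KT\<close>-connection\<close>

definition natural_connection ::
  "('m, 'e::euclidean_space) atlas \<Rightarrow> 'm endo_field \<Rightarrow> 'm vfield \<Rightarrow> 'm form_field
     \<Rightarrow> 'm metric_field \<Rightarrow> 'm connection \<Rightarrow> bool" where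
  "natural_connection \<A> \<phi> \<xi> \<eta> g D \<longleftrightarrow> linear_connection \<A> D \<and>
     (\<forall>X\<in>vector_fields \<A>. D X \<xi> = 0 \<and>
        (\<forall>Y\<in>vector_fields \<A>. cov_endo D \<phi> X Y = 0 \<and> cov_form D \<eta> X Y = 0 \<and>
           (\<forall>Z\<in>vector_fields \<A>. cov_metric D g X Y Z = 0)))"

definition totally_skew_torsion ::
  "('m, 'e::euclidean_space) atlas \<Rightarrow> 'm metric_field \<Rightarrow> 'm connection \<Rightarrow> bool" where
  "totally_skew_torsion \<A> g D \<longleftrightarrow>
     (\<forall>X\<in>vector_fields \<A>. \<forall>Y\<in>vector_fields \<A>. \<forall>Z\<in>vector_fields \<A>. \<forall>p.
        lowered_torsion g D X Y Z p = - lowered_torsion g D Y X Z p \<and>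
        lowered_torsion g D X Y Z p = - lowered_torsion g D X Z Y p)"

definition phiKT_tensor ::
  "'m endo_field \<Rightarrow> 'm vfield \<Rightarrow> 'm form_field
     \<Rightarrow> ('m vfield \<Rightarrow> 'm vfield \<Rightarrow> 'm vfield \<Rightarrow> 'm \<Rightarrow> real)
     \<Rightarrow> 'm vfield \<Rightarrow> 'm vfield \<Rightarrow> 'm vfield \<Rightarrow> 'm \<Rightarrow> real" where
  "phiKT_tensor \<phi> \<xi> \<eta> F X Y Z p =
     - (1 / 2) * cyc (\<lambda>X Y Z. F X Y (endo_app \<phi> Z) p - 3 * \<eta> p (X p) * F Y (endo_app \<phi> Z) \<xi> p) X Y Z"

definition phiKT_connection ::
  "('m, 'e::euclidean_space) atlas \<Rightarrow> 'm endo_field \<Rightarrow> 'm vfield \<Rightarrow> 'm form_field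
     \<Rightarrow> 'm metric_field \<Rightarrow> 'm connection \<Rightarrow> 'm connection \<Rightarrow> bool" where
  "phiKT_connection \<A> \<phi> \<xi> \<eta> g nabla D \<longleftrightarrow>
     natural_connection \<A> \<phi> \<xi> \<eta> g D \<and>
     totally_skew_torsion \<A> g D \<and>
     (\<forall>X\<in>vector_fields \<A>. \<forall>Y\<in>vector_fields \<A>. \<forall>Z\<in>vector_fields \<A>. \<forall>p.
        g p (D X Y p) (Z p) = g p (nabla X Y p) (Z p)
          + 1 / 2 * phiKT_tensor \<phi> \<xi> \<eta> (fundamental_F \<phi> g nabla) X Y Z p)"


section \<open>Classes of torsion tensors\<close>

definition torsion_tensors :: "'a::real_vector set \<Rightarrow> ('a \<Rightarrow> 'a \<Rightarrow> 'a \<Rightarrow> real) set" where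
  "torsion_tensors V = {T. trilinear_on V T \<and> (\<forall>x\<in>V. \<forall>y\<in>V. \<forall>z\<in>V. T x y z = - T y x z)}"

definition T3_class ::
  "'a::real_vector set \<Rightarrow> ('a \<Rightarrow> 'a) \<Rightarrow> 'a \<Rightarrow> ('a \<Rightarrow> 'a \<Rightarrow> 'a \<Rightarrow> real) set" where
  "T3_class V \<phi> \<xi> = {T\<in>torsion_tensors V. \<forall>x\<in>V. \<forall>y\<in>V. \<forall>z\<in>V.
     T \<xi> y z = 0 \<and> T x y \<xi> = 0 \<and>
     T x y z = - T (\<phi> x) (\<phi> y) z \<and> T x y z = T (\<phi> x) y (\<phi> z)}"

definition T6_class ::
  "'a::real_vector set \<Rightarrow> ('a \<Rightarrow> 'a) \<Rightarrow> 'a \<Rightarrow> ('a \<Rightarrow> 'a \<Rightarrow> 'a \<Rightarrow> real) set" where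
  "T6_class V \<phi> \<xi> = {T\<in>torsion_tensors V. \<forall>x\<in>V. \<forall>y\<in>V. \<forall>z\<in>V.
     T \<xi> y z = 0 \<and> T x y \<xi> = 0 \<and>
     T x y z - T (\<phi> x) (\<phi> y) z = 0 \<and> cyc (\<lambda>x y z. T (\<phi> x) y z) x y z = 0}"

definition T7_class ::
  "'a::real_vector set \<Rightarrow> ('a \<Rightarrow> 'a) \<Rightarrow> 'a \<Rightarrow> ('a \<Rightarrow> real) \<Rightarrow> ('a \<Rightarrow> 'a \<Rightarrow> 'a \<Rightarrow> real) set" where
  "T7_class V \<phi> \<xi> \<eta> = {T\<in>torsion_tensors V. \<forall>x\<in>V. \<forall>y\<in>V. \<forall>z\<in>V.
     T x y z = \<eta> z * T (\<phi> (\<phi> x)) (\<phi> (\<phi> y)) \<xi> \<and>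
     T x y \<xi> = - T (\<phi> x) (\<phi> y) \<xi>}"

definition T12_class ::
  "'a::real_vector set \<Rightarrow> ('a \<Rightarrow> 'a) \<Rightarrow> 'a \<Rightarrow> ('a \<Rightarrow> real) \<Rightarrow> ('a \<Rightarrow> 'a \<Rightarrow> 'a \<Rightarrow> real) set" where
  "T12_class V \<phi> \<xi> \<eta> = {T\<in>torsion_tensors V. \<forall>x\<in>V. \<forall>y\<in>V. \<forall>z\<in>V.
     T x y z = \<eta> x * T \<xi> (\<phi> (\<phi> y)) (\<phi> (\<phi> z)) - \<eta> y * T \<xi> (\<phi> (\<phi> x)) (\<phi> (\<phi> z)) \<and>
     T \<xi> y z = - T \<xi> z y \<and> T \<xi> y z = - T \<xi> (\<phi> y) (\<phi> z)}"

end

theory Submission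
  imports Defs
begin

text \<open>
  Since the Levi-Civita connection is torsion-free, the lowered torsion of the \<open>\<phi>\<close>KT-connection is
  the skew part, in its first two arguments, of the tensor \<open>\<Phi>\<close> that \<open>phiKT_tensor\<close> builds from the
  fundamental tensor \<open>F\<close>. The claim thus becomes an algebraic one about \<open>\<Phi>\<close> on a single tangent
  space, and as \<open>\<Phi>\<close> depends linearly on \<open>F = F\<^sub>3 + F\<^sub>7\<close>, the two components can be treated separately.

  The class of \<open>F\<^sub>3\<close> makes \<open>F\<^sub>3(x, y, \<phi>z)\<close> skew in \<open>y, z\<close>, so its cyclic sum is a 3-form \<open>S\<close>, and \<open>S\<close> is
  horizontal (it vanishes on \<open>\<xi>\<close>). A horizontal 3-form splits into the parts on which
  \<open>S(\<phi>x, \<phi>y, z) = \<plusminus> S(x, y, z)\<close>. The invariant part always lies in \<open>\<T>\<^sub>6\<close>; the anti-invariant part lies in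
  \<open>\<T>\<^sub>3\<close> as soon as the cyclic sum of \<open>S(\<phi>x, \<phi>y, z)\<close> is \<open>S\<close> itself, and this identity is what the
  vanishing of the cyclic sum of \<open>F\<^sub>3\<close> provides.

  The tensor \<open>F\<^sub>7\<close> is determined by the 2-form \<open>F\<^sub>7(x, y, \<xi>)\<close>, and \<open>w(x, y) = F\<^sub>7(x, \<phi>y, \<xi>)\<close> is again a
  2-form with \<open>w(\<phi>x, \<phi>y) = - w(x, y)\<close>. The contribution of \<open>F\<^sub>7\<close> to \<open>\<Phi>\<close> is twice the 3-form \<open>\<eta> \<and> w\<close>. Its
  summand containing \<open>\<eta>(z)\<close> lies in \<open>\<T>\<^sub>7\<close>, the other two together in \<open>\<T>\<^sub>1\<^sub>2\<close>.
\<close>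


section \<open>Multilinear maps on a subspace\<close>

lemma linear_onD:
  assumes "linear_on V f"
  shows "x \<in> V \<Longrightarrow> y \<in> V \<Longrightarrow> f (x + y) = f x + f y"
    and "x \<in> V \<Longrightarrow> f (a *\<^sub>R x) = a *\<^sub>R f x"
  using assms by (auto simp: linear_on_def)

lemma linear_on_diff:
  assumes "subspace V" "linear_on V f" "x \<in> V" "y \<in> V"
  shows "f (x - y) = f x - f y"
proof -
  have "f (x + (- 1) *\<^sub>R y) = f x + f ((- 1) *\<^sub>R y)"
    using assms by (intro linear_onD(1)[OF assms(2)] subspace_scale)
  also have "f ((- 1) *\<^sub>R y) = (- 1) *\<^sub>R f y"
    using assms by (intro linear_onD(2)[OF assms(2)])
  finally show ?thesis by simp
qed

lemma linear_on_const_mult: "linear_on V f \<Longrightarrow> linear_on V (\<lambda>x. c * f x :: real)"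
  by (simp add: linear_on_def algebra_simps)

lemma linear_on_mult_const: "linear_on V f \<Longrightarrow> linear_on V (\<lambda>x. f x * c :: real)"
  by (simp add: linear_on_def algebra_simps)

lemma linear_on_add: "linear_on V f \<Longrightarrow> linear_on V h \<Longrightarrow> linear_on V (\<lambda>x. f x + h x)"
  by (simp add: linear_on_def algebra_simps)

lemma linear_on_compose:
  "linear_on V f \<Longrightarrow> linear_on V k \<Longrightarrow> k ` V \<subseteq> V \<Longrightarrow> linear_on V (\<lambda>x. f (k x))"
  by (simp add: linear_on_def image_subset_iff)

lemma linear_on_ident: "linear_on V (\<lambda>x. x)"
  by (simp add: linear_on_def)

lemma trilinear_onD:
  assumes "trilinear_on V t" "x \<in> V" "y \<in> V"
  shows "linear_on V (t x y)" "linear_on V (\<lambda>z. t x z y)" "linear_on V (\<lambda>z. t z x y)"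
  using assms by (auto simp: trilinear_on_def)

lemma trilinear_on_add:
  "trilinear_on V t \<Longrightarrow> trilinear_on V u \<Longrightarrow> trilinear_on V (\<lambda>x y z. t x y z + u x y z)"
  by (simp add: trilinear_on_def linear_on_add)

lemma trilinear_on_scale: "trilinear_on V t \<Longrightarrow> trilinear_on V (\<lambda>x y z. c * t x y z)"
  by (simp add: trilinear_on_def linear_on_const_mult)

lemma trilinear_on_rotate: "trilinear_on V t \<Longrightarrow> trilinear_on V (\<lambda>x y z. t y z x)"
  by (simp add: trilinear_on_def)

lemma trilinear_on_cyc:
  assumes "trilinear_on V t"
  shows "trilinear_on V (cyc t)"
proof -
  have "trilinear_on V (\<lambda>x y z. t x y z + t y z x + t z x y)"
    using assms trilinear_on_rotate[OF assms] trilinear_on_rotate[OF trilinear_on_rotate[OF assms]]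
    by (intro trilinear_on_add) simp_all
  moreover have "(\<lambda>x y z. t x y z + t y z x + t z x y) = cyc t"
    by (simp add: cyc_def fun_eq_iff)
  ultimately show ?thesis by simp
qed

lemma trilinear_on_compose:
  assumes "trilinear_on V t"
    and "linear_on V f" "f ` V \<subseteq> V" "linear_on V h" "h ` V \<subseteq> V" "linear_on V k" "k ` V \<subseteq> V"
  shows "trilinear_on V (\<lambda>x y z. t (f x) (h y) (k z))"
  unfolding trilinear_on_def
proof (intro ballI conjI)
  fix x y assume "x \<in> V" "y \<in> V"
  with assms have "f x \<in> V" "h x \<in> V" "h y \<in> V" "k y \<in> V" by auto
  then show "linear_on V (\<lambda>z. t (f x) (h y) (k z))" "linear_on V (\<lambda>z. t (f x) (h z) (k y))"
    "linear_on V (\<lambda>z. t (f z) (h x) (k y))"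
    using assms
      linear_on_compose[OF trilinear_onD(1)[OF assms(1)], of "f x" "h y" k]
      linear_on_compose[OF trilinear_onD(2)[OF assms(1)], of "f x" "k y" h]
      linear_on_compose[OF trilinear_onD(3)[OF assms(1)], of "h x" "k y" f]
    by auto
qed

lemma trilinear_on_form_times_bilinear:
  assumes "linear_on V \<eta>" "bilinear_on V w"
  shows "trilinear_on V (\<lambda>x y z. \<eta> x * w y z)"
  using assms
  by (simp add: trilinear_on_def bilinear_on_def linear_on_const_mult linear_on_mult_const)


section \<open>The algebra of a single tangent space\<close>

locale almost_contact_space =
  fixes V :: "'a::real_vector set" and \<phi> :: "'a \<Rightarrow> 'a" and \<xi> :: 'a and \<eta> :: "'a \<Rightarrow> real"
  assumes subspace: "subspace V"
    and phi_closed: "\<phi> ` V \<subseteq> V" and phi_linear: "linear_on V \<phi>"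
    and xi_in: "\<xi> \<in> V"
    and eta_linear: "linear_on V \<eta>"
    and phi_xi: "\<phi> \<xi> = 0" and eta_xi: "\<eta> \<xi> = 1"
    and phi_phi: "x \<in> V \<Longrightarrow> \<phi> (\<phi> x) = - x + \<eta> x *\<^sub>R \<xi>"
    and eta_phi: "x \<in> V \<Longrightarrow> \<eta> (\<phi> x) = 0"
begin

lemma phi_in: "x \<in> V \<Longrightarrow> \<phi> x \<in> V"
  using phi_closed by auto

text \<open>A linear map that kills \<open>\<xi>\<close> does not see the \<open>\<xi>\<close>-component of \<open>\<phi>\<^sup>2\<close>, so \<open>\<phi>\<close> acts on
  horizontal tensors as a complex structure.\<close>

lemma horizontal_phi_phi:
  fixes f :: "'a \<Rightarrow> real"
  assumes "linear_on V f" "f \<xi> = 0" "x \<in> V"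
  shows "f (\<phi> (\<phi> x)) = - f x"
proof -
  have "f (\<eta> x *\<^sub>R \<xi> - x) = f (\<eta> x *\<^sub>R \<xi>) - f x"
    using assms subspace xi_in by (intro linear_on_diff) (auto intro: subspace_scale)
  also have "f (\<eta> x *\<^sub>R \<xi>) = 0"
    using assms xi_in linear_onD(2)[OF assms(1)] by simp
  finally show ?thesis using assms by (simp add: phi_phi)
qed

lemma linear_zero:
  fixes f :: "'a \<Rightarrow> real"
  assumes "linear_on V f"
  shows "f 0 = 0"
  using linear_onD(2)[OF assms xi_in, of 0] by simp

text \<open>The splitting of a horizontal 3-form by the involution \<open>S(x, y, z) \<mapsto> S(\<phi>x, \<phi>y, z)\<close>. The cyclic
  condition of \<open>\<T>\<^sub>6\<close> comes from the total skew-symmetry alone: the six terms of the sum cancel in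
  pairs.\<close>

lemma horizontal_three_form_splitting:
  assumes tri: "trilinear_on V S"
    and skew12: "\<And>x y z. x \<in> V \<Longrightarrow> y \<in> V \<Longrightarrow> z \<in> V \<Longrightarrow> S x y z = - S y x z"
    and skew23: "\<And>x y z. x \<in> V \<Longrightarrow> y \<in> V \<Longrightarrow> z \<in> V \<Longrightarrow> S x y z = - S x z y"
    and hor: "\<And>y z. y \<in> V \<Longrightarrow> z \<in> V \<Longrightarrow> S \<xi> y z = 0"
    and phi_cyc: "\<And>x y z. x \<in> V \<Longrightarrow> y \<in> V \<Longrightarrow> z \<in> V \<Longrightarrow>
      cyc (\<lambda>x y z. S (\<phi> x) (\<phi> y) z) x y z = S x y z"
  shows "(\<lambda>x y z. 1 / 2 * (S x y z + (- 1) * S (\<phi> x) (\<phi> y) z)) \<in> T3_class V \<phi> \<xi>"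
    and "(\<lambda>x y z. 1 / 2 * (S x y z + S (\<phi> x) (\<phi> y) z)) \<in> T6_class V \<phi> \<xi>"
proof -
  have rotate: "S x y z = S y z x" if "x \<in> V" "y \<in> V" "z \<in> V" for x y z
    using skew12[of x y z] skew23[of y x z] that by simp
  have hor2: "S x \<xi> z = 0" and hor3: "S x z \<xi> = 0" if "x \<in> V" "z \<in> V" for x z
    using skew12[of x \<xi> z] skew23[of x z \<xi>] hor that xi_in by simp_all
  have phi1: "S (\<phi> (\<phi> x)) y z = - S x y z"
    and phi2: "S y (\<phi> (\<phi> x)) z = - S y x z"
    and phi3: "S y z (\<phi> (\<phi> x)) = - S y z x" if "x \<in> V" "y \<in> V" "z \<in> V" for x y z
    using that hor hor2 hor3
      horizontal_phi_phi[OF trilinear_onD(3)[OF tri, of y z], of x]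
      horizontal_phi_phi[OF trilinear_onD(2)[OF tri, of y z], of x]
      horizontal_phi_phi[OF trilinear_onD(1)[OF tri, of y z], of x]
    by simp_all
  have zero: "S 0 y z = 0" if "y \<in> V" "z \<in> V" for y z
    using that by (intro linear_zero[where f = "\<lambda>x. S x y z"] trilinear_onD[OF tri])
  have tri_phi: "trilinear_on V (\<lambda>x y z. S (\<phi> x) (\<phi> y) z)"
    using trilinear_on_compose[OF tri phi_linear phi_closed phi_linear phi_closed linear_on_ident]
    by simp
  have skew_phi: "S (\<phi> x) (\<phi> y) z = - S (\<phi> y) (\<phi> x) z" if "x \<in> V" "y \<in> V" "z \<in> V" for x y z
    using that by (intro skew12 phi_in)
  have expand: "S x y z = S (\<phi> x) (\<phi> y) z + S x (\<phi> y) (\<phi> z) + S (\<phi> x) y (\<phi> z)"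
    if "x \<in> V" "y \<in> V" "z \<in> V" for x y z
    using phi_cyc[of x y z] rotate[of x "\<phi> y" "\<phi> z"] rotate[of "\<phi> z" "\<phi> x" y] that
    by (simp add: cyc_def phi_in)
  show "(\<lambda>x y z. 1 / 2 * (S x y z + (- 1) * S (\<phi> x) (\<phi> y) z)) \<in> T3_class V \<phi> \<xi>"
    unfolding T3_class_def torsion_tensors_def mem_Collect_eq
  proof (intro conjI ballI)
    show "trilinear_on V (\<lambda>x y z. 1 / 2 * (S x y z + (- 1) * S (\<phi> x) (\<phi> y) z))"
      using tri tri_phi by (intro trilinear_on_scale trilinear_on_add)
  next
    fix x y z assume v: "x \<in> V" "y \<in> V" "z \<in> V"
    show "1 / 2 * (S x y z + - 1 * S (\<phi> x) (\<phi> y) z) = - (1 / 2 * (S y x z + - 1 * S (\<phi> y) (\<phi> x) z))"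
      by (simp add: skew12[OF v] skew_phi[OF v] field_simps)
    show "1 / 2 * (S \<xi> y z + - 1 * S (\<phi> \<xi>) (\<phi> y) z) = 0"
      using v by (simp add: hor phi_xi zero phi_in)
    show "1 / 2 * (S x y \<xi> + - 1 * S (\<phi> x) (\<phi> y) \<xi>) = 0"
      using v by (simp add: hor3 phi_in)
    show "1 / 2 * (S x y z + - 1 * S (\<phi> x) (\<phi> y) z) =
        - (1 / 2 * (S (\<phi> x) (\<phi> y) z + - 1 * S (\<phi> (\<phi> x)) (\<phi> (\<phi> y)) z))"
      using v by (simp add: phi1 phi2 phi_in field_simps)
    show "1 / 2 * (S x y z + - 1 * S (\<phi> x) (\<phi> y) z) =
        1 / 2 * (S (\<phi> x) y (\<phi> z) + - 1 * S (\<phi> (\<phi> x)) (\<phi> y) (\<phi> z))"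
      using v expand[of x y z] by (simp add: phi1 phi_in)
  qed
  show "(\<lambda>x y z. 1 / 2 * (S x y z + S (\<phi> x) (\<phi> y) z)) \<in> T6_class V \<phi> \<xi>"
    unfolding T6_class_def torsion_tensors_def mem_Collect_eq
  proof (intro conjI ballI)
    show "trilinear_on V (\<lambda>x y z. 1 / 2 * (S x y z + S (\<phi> x) (\<phi> y) z))"
      using tri tri_phi by (intro trilinear_on_scale trilinear_on_add)
  next
    fix x y z assume v: "x \<in> V" "y \<in> V" "z \<in> V"
    show "1 / 2 * (S x y z + S (\<phi> x) (\<phi> y) z) = - (1 / 2 * (S y x z + S (\<phi> y) (\<phi> x) z))"
      by (simp add: skew12[OF v] skew_phi[OF v] field_simps)
    show "1 / 2 * (S \<xi> y z + S (\<phi> \<xi>) (\<phi> y) z) = 0"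
      using v by (simp add: hor phi_xi zero phi_in)
    show "1 / 2 * (S x y \<xi> + S (\<phi> x) (\<phi> y) \<xi>) = 0"
      using v by (simp add: hor3 phi_in)
    show "1 / 2 * (S x y z + S (\<phi> x) (\<phi> y) z) -
        1 / 2 * (S (\<phi> x) (\<phi> y) z + S (\<phi> (\<phi> x)) (\<phi> (\<phi> y)) z) = 0"
      using v by (simp add: phi1 phi2 phi_in)
    show "cyc (\<lambda>x y z. 1 / 2 * (S (\<phi> x) y z + S (\<phi> (\<phi> x)) (\<phi> y) z)) x y z = 0"
      using v rotate[of x "\<phi> y" z] rotate[of y "\<phi> z" x] rotate[of z "\<phi> x" y]
      by (simp add: cyc_def phi1 phi_in field_simps)
  qed
qed

text \<open>The two halves of the 3-form \<open>\<eta> \<and> w\<close>, for a 2-form \<open>w\<close> that is anti-invariant under \<open>\<phi>\<close>. Such a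
  \<open>w\<close> is automatically horizontal, because \<open>\<phi>\<xi> = 0\<close>.\<close>

lemma vertical_three_form_splitting:
  assumes bi: "bilinear_on V w"
    and skew: "\<And>x y. x \<in> V \<Longrightarrow> y \<in> V \<Longrightarrow> w x y = - w y x"
    and anti: "\<And>x y. x \<in> V \<Longrightarrow> y \<in> V \<Longrightarrow> w (\<phi> x) (\<phi> y) = - w x y"
  shows "(\<lambda>x y z. \<eta> z * w x y) \<in> T7_class V \<phi> \<xi> \<eta>"
    and "(\<lambda>x y z. \<eta> x * w y z + (- 1) * (\<eta> y * w x z)) \<in> T12_class V \<phi> \<xi> \<eta>"
proof -
  have lin: "linear_on V (\<lambda>x. w x y)" if "y \<in> V" for y
    using bi that by (auto simp: bilinear_on_def)
  have hor: "w \<xi> y = 0" "w y \<xi> = 0" if "y \<in> V" for y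
    using anti[of \<xi> y] skew[of y \<xi>] that xi_in linear_zero[OF lin[of "\<phi> y"]]
    by (simp_all add: phi_xi phi_in)
  have inv: "w (\<phi> (\<phi> x)) (\<phi> (\<phi> y)) = w x y" if "x \<in> V" "y \<in> V" for x y
    using that by (simp add: anti phi_in)
  have tri: "trilinear_on V (\<lambda>x y z. \<eta> x * w y z)"
    using eta_linear bi by (rule trilinear_on_form_times_bilinear)
  have tri7: "trilinear_on V (\<lambda>x y z. \<eta> z * w x y)"
    using trilinear_on_rotate[OF trilinear_on_rotate[OF tri]] by simp
  have tri12: "trilinear_on V (\<lambda>x y z. \<eta> x * w y z + (- 1) * (\<eta> y * w x z))"
    using tri by (intro trilinear_on_add trilinear_on_scale) (simp_all add: trilinear_on_def)
  show "(\<lambda>x y z. \<eta> z * w x y) \<in> T7_class V \<phi> \<xi> \<eta>"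
    unfolding T7_class_def torsion_tensors_def mem_Collect_eq
  proof (intro conjI ballI)
    fix x y z assume v: "x \<in> V" "y \<in> V" "z \<in> V"
    show "\<eta> z * w x y = - (\<eta> z * w y x)"
      using skew[of x y] v by simp
  qed (use tri7 in \<open>simp_all add: eta_xi inv anti\<close>)
  show "(\<lambda>x y z. \<eta> x * w y z + (- 1) * (\<eta> y * w x z)) \<in> T12_class V \<phi> \<xi> \<eta>"
    unfolding T12_class_def torsion_tensors_def mem_Collect_eq
  proof (intro conjI ballI)
    fix x y z assume v: "x \<in> V" "y \<in> V" "z \<in> V"
    show "\<eta> \<xi> * w y z + - 1 * (\<eta> y * w \<xi> z) = - (\<eta> \<xi> * w z y + - 1 * (\<eta> z * w \<xi> y))"
      using skew[of y z] v by (simp add: hor eta_xi)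
  qed (use tri12 in \<open>simp_all add: eta_xi eta_phi hor inv anti phi_in xi_in\<close>)
qed

lemma F_tensors_D:
  assumes "F \<in> F_tensors V \<phi> \<xi> \<eta>"
  shows "trilinear_on V F"
    and "x \<in> V \<Longrightarrow> y \<in> V \<Longrightarrow> z \<in> V \<Longrightarrow> F x y z = F x z y"
    and "x \<in> V \<Longrightarrow> y \<in> V \<Longrightarrow> z \<in> V \<Longrightarrow>
      F x y z = F x (\<phi> y) (\<phi> z) + \<eta> y * F x \<xi> z + \<eta> z * F x y \<xi>"
  using assms unfolding F_tensors_def mem_Collect_eq by blast+

lemma F3_class_D:
  assumes "F \<in> F3_class V \<phi> \<xi> \<eta>"
  shows "F \<in> F_tensors V \<phi> \<xi> \<eta>"
    and "y \<in> V \<Longrightarrow> z \<in> V \<Longrightarrow> F \<xi> y z = 0"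
    and "x \<in> V \<Longrightarrow> z \<in> V \<Longrightarrow> F x \<xi> z = 0"
    and "x \<in> V \<Longrightarrow> y \<in> V \<Longrightarrow> F x y \<xi> = 0"
    and "x \<in> V \<Longrightarrow> y \<in> V \<Longrightarrow> z \<in> V \<Longrightarrow> F x y z + F y z x + F z x y = 0"
proof -
  show F: "F \<in> F_tensors V \<phi> \<xi> \<eta>"
    using assms by (simp add: F3_class_def)
  show "F \<xi> y z = 0" if "y \<in> V" "z \<in> V" for y z
    using assms that xi_in by (simp add: F3_class_def)
  show *: "F x \<xi> z = 0" if "x \<in> V" "z \<in> V" for x z
    using assms that xi_in by (simp add: F3_class_def)
  show "F x y \<xi> = 0" if "x \<in> V" "y \<in> V" for x y
    using F_tensors_D(2)[OF F that xi_in] *[OF that] by simp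
  show "F x y z + F y z x + F z x y = 0" if "x \<in> V" "y \<in> V" "z \<in> V" for x y z
    using assms that by (simp add: F3_class_def cyc_def)
qed

text \<open>On the class \<open>\<F>\<^sub>3\<close> the compatibility of \<open>F\<close> with \<open>\<phi>\<close> allows \<open>\<phi>\<close> to change its slot at the cost of
  a sign; with the symmetry of \<open>F\<close> this is the skew-symmetry of \<open>F(x, y, \<phi>z)\<close> in \<open>y, z\<close>.\<close>

lemma F3_phi_swap:
  assumes "F \<in> F3_class V \<phi> \<xi> \<eta>" "x \<in> V" "y \<in> V" "z \<in> V"
  shows "F x (\<phi> y) z = - F x y (\<phi> z)"
proof -
  note F = F3_class_D[OF assms(1)]
  have "F x (\<phi> y) z = F x (\<phi> (\<phi> y)) (\<phi> z)"
    using assms F_tensors_D(3)[OF F(1), of x "\<phi> y" z] F(3)[of x z] F(4)[of x "\<phi> y"]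
    by (simp add: phi_in)
  also have "\<dots> = - F x y (\<phi> z)"
    using assms F(3)[of x "\<phi> z"]
    by (intro horizontal_phi_phi[where f = "\<lambda>y. F x y (\<phi> z)"]
        trilinear_onD(2)[OF F_tensors_D(1)[OF F(1)]]) (auto simp: phi_in)
  finally show ?thesis .
qed

text \<open>With \<open>a\<close>, \<open>b\<close>, \<open>c\<close> the three terms of the cyclic sum of \<open>F(x, y, \<phi>z)\<close>, the vanishing of the
  cyclic sum of \<open>F\<close> turns \<open>S(\<phi>x, \<phi>y, z)\<close> into \<open>3c - a - b\<close>, up to the common factor of \<open>S\<close>, and
  these values add up cyclically to \<open>a + b + c\<close>.\<close>

lemma F3_cyclic_sum:
  assumes F: "F \<in> F3_class V \<phi> \<xi> \<eta>"
    and S_def: "S = (\<lambda>x y z. - (1 / 2) * cyc (\<lambda>x y z. F x y (\<phi> z)) x y z)"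
  shows "trilinear_on V S"
    and "\<And>x y z. x \<in> V \<Longrightarrow> y \<in> V \<Longrightarrow> z \<in> V \<Longrightarrow> S x y z = - S y x z"
    and "\<And>x y z. x \<in> V \<Longrightarrow> y \<in> V \<Longrightarrow> z \<in> V \<Longrightarrow> S x y z = - S x z y"
    and "\<And>y z. y \<in> V \<Longrightarrow> z \<in> V \<Longrightarrow> S \<xi> y z = 0"
    and "\<And>x y z. x \<in> V \<Longrightarrow> y \<in> V \<Longrightarrow> z \<in> V \<Longrightarrow>
      cyc (\<lambda>x y z. S (\<phi> x) (\<phi> y) z) x y z = S x y z"
proof -
  note hor = F3_class_D(2-4)[OF F] and cyc0 = F3_class_D(5)[OF F]
  note tri = F_tensors_D(1)[OF F3_class_D(1)[OF F]] and sym = F_tensors_D(2)[OF F3_class_D(1)[OF F]]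
  have swap: "F x (\<phi> y) z = - F x y (\<phi> z)" if "x \<in> V" "y \<in> V" "z \<in> V" for x y z
    using F that by (rule F3_phi_swap)
  have skew: "F x y (\<phi> z) = - F x z (\<phi> y)" if "x \<in> V" "y \<in> V" "z \<in> V" for x y z
    using swap[of x z y] sym[of x "\<phi> z" y] that by (simp add: phi_in)
  have zero: "F x y 0 = 0" if "x \<in> V" "y \<in> V" for x y
    using linear_zero[OF trilinear_onD(1)[OF tri that]] .
  have first: "F (\<phi> x) y z = F z x (\<phi> y) - F y z (\<phi> x)" if "x \<in> V" "y \<in> V" "z \<in> V" for x y z
    using cyc0[of "\<phi> x" y z] swap[of z x y] that by (simp add: phi_in)
  have phi2: "F x y (\<phi> (\<phi> z)) = - F x y z" if "x \<in> V" "y \<in> V" "z \<in> V" for x y z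
    using that hor by (intro horizontal_phi_phi[where f = "F x y"] trilinear_onD(1)[OF tri]) auto
  have at_phi: "S (\<phi> x) (\<phi> y) z
      = - (1 / 2) * (3 * F z x (\<phi> y) - F x y (\<phi> z) - F y z (\<phi> x))"
    if v: "x \<in> V" "y \<in> V" "z \<in> V" for x y z
  proof -
    have "F (\<phi> x) (\<phi> y) (\<phi> z) = F z x (\<phi> y) - F y z (\<phi> x)"
      using v swap[of "\<phi> x" y "\<phi> z"] phi2[of "\<phi> x" y z] first[of x y z] by (simp add: phi_in)
    moreover have "F (\<phi> y) z (\<phi> (\<phi> x)) = F z x (\<phi> y) - F x y (\<phi> z)"
      using v phi2[of "\<phi> y" z x] first[of y z x] skew[of z x y] skew[of x y z]
      by (simp add: phi_in)
    moreover have "F z (\<phi> x) (\<phi> (\<phi> y)) = F z x (\<phi> y)"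
      using v phi2[of z "\<phi> x" y] swap[of z x y] by (simp add: phi_in)
    ultimately show ?thesis by (simp add: S_def cyc_def)
  qed
  have "trilinear_on V (\<lambda>x y z. F x y (\<phi> z))"
    using trilinear_on_compose[OF tri linear_on_ident _ linear_on_ident _ phi_linear phi_closed]
    by simp
  then show "trilinear_on V S"
    unfolding S_def by (intro trilinear_on_scale trilinear_on_cyc)
  fix x y z assume v: "x \<in> V" "y \<in> V" "z \<in> V"
  show "S x y z = - S y x z" "S x y z = - S x z y"
    using v skew[of x y z] skew[of y z x] skew[of z x y]
    by (simp_all add: S_def cyc_def field_simps)
  show "cyc (\<lambda>x y z. S (\<phi> x) (\<phi> y) z) x y z = S x y z"
    unfolding cyc_def at_phi[OF v] at_phi[OF v(2,3,1)] at_phi[OF v(3,1,2)]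
    by (simp add: S_def cyc_def field_simps)
  show "S \<xi> y z = 0"
    using v xi_in by (simp add: S_def cyc_def phi_xi phi_in hor zero)
qed

text \<open>Applying \<open>f(\<phi>x, \<phi>y) = - f(x, y)\<close>, for \<open>f(x, y) = F(x, y, \<xi>)\<close>, to the pair \<open>x, \<phi>y\<close> shows that
  \<open>\<phi>\<close> is symmetric for \<open>f\<close>: \<open>f(\<phi>x, y) = f(x, \<phi>y)\<close>. This is why \<open>w\<close> inherits the skew-symmetry of
  \<open>f\<close>.\<close>

lemma F7_two_form:
  assumes F: "F \<in> F7_class V n \<phi> \<xi> \<eta> g"
  defines "w \<equiv> \<lambda>x y. F x (\<phi> y) \<xi>"
  shows "bilinear_on V w"
    and "\<And>x y. x \<in> V \<Longrightarrow> y \<in> V \<Longrightarrow> w x y = - w y x"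
    and "\<And>x y. x \<in> V \<Longrightarrow> y \<in> V \<Longrightarrow> w (\<phi> x) (\<phi> y) = - w x y"
    and "\<And>x y z. x \<in> V \<Longrightarrow> y \<in> V \<Longrightarrow> z \<in> V \<Longrightarrow> F x y (\<phi> z) = \<eta> y * w x z"
proof -
  have tri: "trilinear_on V F" using F by (simp add: F7_class_def F_tensors_def)
  have shape: "F x y z = F x y \<xi> * \<eta> z + F x z \<xi> * \<eta> y" if "x \<in> V" "y \<in> V" "z \<in> V" for x y z
    using F that unfolding F7_class_def by blast
  have skew: "F x y \<xi> = - F y x \<xi>" if "x \<in> V" "y \<in> V" for x y
    using F that unfolding F7_class_def by blast
  have anti: "F (\<phi> x) (\<phi> y) \<xi> = - F x y \<xi>" if "x \<in> V" "y \<in> V" for x y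
    using F that unfolding F7_class_def mem_Collect_eq
    by (metis minus_equation_iff)
  \<comment> \<open>at \<open>y = z = \<xi>\<close> the shape of \<open>F\<close> reads \<open>F(x, \<xi>, \<xi>) = 2 F(x, \<xi>, \<xi>)\<close>\<close>
  have hor: "F x \<xi> \<xi> = 0" if "x \<in> V" for x
    using shape[of x \<xi> \<xi>] that xi_in by (simp add: eta_xi)
  have phi2: "F x (\<phi> (\<phi> y)) \<xi> = - F x y \<xi>" if "x \<in> V" "y \<in> V" for x y
    using that hor xi_in
    by (intro horizontal_phi_phi[where f = "\<lambda>y. F x y \<xi>"] trilinear_onD[OF tri]) auto
  show "bilinear_on V w"
    unfolding bilinear_on_def w_def
    using trilinear_onD(3)[OF tri phi_in xi_in]
      linear_on_compose[OF trilinear_onD(2)[OF tri _ xi_in] phi_linear phi_closed]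
    by simp
  fix x y assume v: "x \<in> V" "y \<in> V"
  show "w x y = - w y x"
    using v anti[of x "\<phi> y"] phi2[of "\<phi> x" y] skew[of "\<phi> x" y] by (simp add: w_def phi_in)
  show "w (\<phi> x) (\<phi> y) = - w x y"
    using v anti[of x "\<phi> y"] by (simp add: w_def phi_in)
  fix z assume "z \<in> V"
  then show "F x y (\<phi> z) = \<eta> y * w x z"
    using v shape[of x y "\<phi> z"] by (simp add: w_def eta_phi phi_in)
qed

text \<open>\<open>F\<^sub>3\<close> contributes nothing to the terms with \<open>\<eta>\<close>. For \<open>F\<^sub>7\<close> the first term of the cyclic sum gives
  \<open>- (\<eta>(x) w(y, z) + \<dots>)\<close> and the second \<open>- 3 (\<eta>(x) w(y, z) + \<dots>)\<close>, which explains the factor 2.\<close>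

lemma phiKT_value:
  assumes F\<^sub>3: "F\<^sub>3 \<in> F3_class V \<phi> \<xi> \<eta>" and F\<^sub>7: "F\<^sub>7 \<in> F7_class V n \<phi> \<xi> \<eta> g"
    and v: "x \<in> V" "y \<in> V" "z \<in> V"
  defines "F \<equiv> \<lambda>x y z. F\<^sub>3 x y z + F\<^sub>7 x y z"
    and "w \<equiv> \<lambda>x y. F\<^sub>7 x (\<phi> y) \<xi>"
  shows "- (1 / 2) * cyc (\<lambda>x y z. F x y (\<phi> z) - 3 * \<eta> x * F y (\<phi> z) \<xi>) x y z =
    - (1 / 2) * cyc (\<lambda>x y z. F\<^sub>3 x y (\<phi> z)) x y z
      + 2 * (\<eta> x * w y z + \<eta> y * w z x + \<eta> z * w x y)"
proof -
  have "F\<^sub>3 x (\<phi> y) \<xi> = 0" if "x \<in> V" "y \<in> V" for x y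
    using F3_class_D(4)[OF F\<^sub>3] that by (simp add: phi_in)
  moreover have "F\<^sub>7 a b (\<phi> c) = \<eta> b * w a c" if "a \<in> V" "b \<in> V" "c \<in> V" for a b c
    using F7_two_form(4)[OF F\<^sub>7 that] by (simp only: w_def)
  moreover have "w a b = - w b a" if "a \<in> V" "b \<in> V" for a b
    using F7_two_form(2)[OF F\<^sub>7 that] by (simp only: w_def)
  from this[of x z] this[of y x] this[of z y]
  have "w x z = - w z x" "w y x = - w x y" "w z y = - w y z"
    using v by blast+
  moreover have "F\<^sub>7 x (\<phi> y) \<xi> = w x y" for x y by (simp add: w_def)
  ultimately show ?thesis using v by (simp add: cyc_def F_def algebra_simps)
qed

text \<open>The two splittings above combine; the 2-form is taken as \<open>u = 2w\<close> to absorb the factor of the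
  vertical part.\<close>

lemma phiKT_tensor_decomposition:
  assumes F\<^sub>3: "F\<^sub>3 \<in> F3_class V \<phi> \<xi> \<eta>" and F\<^sub>7: "F\<^sub>7 \<in> F7_class V n \<phi> \<xi> \<eta> g"
  defines "F \<equiv> \<lambda>x y z. F\<^sub>3 x y z + F\<^sub>7 x y z"
  obtains T\<^sub>3 T\<^sub>6 T\<^sub>7 T\<^sub>1\<^sub>2 where
    "T\<^sub>3 \<in> T3_class V \<phi> \<xi>" "T\<^sub>6 \<in> T6_class V \<phi> \<xi>"
    "T\<^sub>7 \<in> T7_class V \<phi> \<xi> \<eta>" "T\<^sub>1\<^sub>2 \<in> T12_class V \<phi> \<xi> \<eta>"
    "\<And>x y z. x \<in> V \<Longrightarrow> y \<in> V \<Longrightarrow> z \<in> V \<Longrightarrow>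
      - (1 / 2) * cyc (\<lambda>x y z. F x y (\<phi> z) - 3 * \<eta> x * F y (\<phi> z) \<xi>) x y z =
      T\<^sub>3 x y z + T\<^sub>6 x y z + T\<^sub>7 x y z + T\<^sub>1\<^sub>2 x y z"
proof -
  define S where "S = (\<lambda>x y z. - (1 / 2) * cyc (\<lambda>x y z. F\<^sub>3 x y (\<phi> z)) x y z)"
  define u where "u = (\<lambda>x y. 2 * F\<^sub>7 x (\<phi> y) \<xi>)"
  note w = F7_two_form[OF F\<^sub>7]
  have bi: "bilinear_on V u"
    using w(1) by (simp add: bilinear_on_def u_def linear_on_const_mult)
  have skew: "u x y = - u y x" if "x \<in> V" "y \<in> V" for x y
    using w(2)[OF that] by (simp add: u_def)
  have anti: "u (\<phi> x) (\<phi> y) = - u x y" if "x \<in> V" "y \<in> V" for x y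
    using w(3)[OF that] by (simp add: u_def)
  note S = F3_cyclic_sum[OF F\<^sub>3 S_def]
  have T:
    "(\<lambda>x y z. 1 / 2 * (S x y z + (- 1) * S (\<phi> x) (\<phi> y) z)) \<in> T3_class V \<phi> \<xi>"
    "(\<lambda>x y z. 1 / 2 * (S x y z + S (\<phi> x) (\<phi> y) z)) \<in> T6_class V \<phi> \<xi>"
    by (rule horizontal_three_form_splitting; (rule S; assumption))+
  have U:
    "(\<lambda>x y z. \<eta> z * u x y) \<in> T7_class V \<phi> \<xi> \<eta>"
    "(\<lambda>x y z. \<eta> x * u y z + (- 1) * (\<eta> y * u x z)) \<in> T12_class V \<phi> \<xi> \<eta>"
    by (rule vertical_three_form_splitting; (rule bi skew anti; assumption))+
  show ?thesis
  proof (rule that[OF T U], goal_cases)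
    case (1 x y z)
    then have "- (1 / 2) * cyc (\<lambda>x y z. F x y (\<phi> z) - 3 * \<eta> x * F y (\<phi> z) \<xi>) x y z
        = S x y z + (\<eta> x * u y z + \<eta> y * u z x + \<eta> z * u x y)"
      unfolding F_def S_def by (subst phiKT_value[OF F\<^sub>3 F\<^sub>7]) (simp_all add: u_def algebra_simps)
    also have "u z x = - u x z" using 1 by (intro skew)
    finally show ?case by (simp add: algebra_simps)
  qed
qed

end


section \<open>From the connection to a tangent space\<close>

text \<open>As \<open>\<nabla>\<close> is torsion-free, \<open>[X, Y]\<close> is \<open>\<nabla>\<^sub>X Y - \<nabla>\<^sub>Y X\<close>, so that only the deformation of \<open>\<nabla>\<close>
  contributes to the torsion.\<close>

lemma lowered_torsion_of_deformation:
  assumes V: "subspace (tangent_space \<A> p)"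
    and g: "bilinear_on (tangent_space \<A> p) (g p)"
    and nabla: "levi_civita \<A> g nabla"
    and D: "linear_connection \<A> D"
    and deform: "\<And>X Y Z. X \<in> vector_fields \<A> \<Longrightarrow> Y \<in> vector_fields \<A> \<Longrightarrow> Z \<in> vector_fields \<A> \<Longrightarrow>
      g p (D X Y p) (Z p) = g p (nabla X Y p) (Z p) + 1 / 2 * Q X Y Z p"
    and XYZ: "X \<in> vector_fields \<A>" "Y \<in> vector_fields \<A>" "Z \<in> vector_fields \<A>"
  shows "lowered_torsion g D X Y Z p = 1 / 2 * (Q X Y Z p - Q Y X Z p)"
proof -
  have in_T: "W p \<in> tangent_space \<A> p" if "W \<in> vector_fields \<A>" for W
    using that by (auto simp: vector_fields_def)
  have D_in: "D X Y p \<in> tangent_space \<A> p" "D Y X p \<in> tangent_space \<A> p"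
    and nabla_in: "nabla X Y p \<in> tangent_space \<A> p" "nabla Y X p \<in> tangent_space \<A> p"
    using D nabla XYZ in_T by (auto simp: levi_civita_def linear_connection_def)
  have "torsion nabla X Y = 0" using nabla XYZ by (simp add: levi_civita_def)
  then have "lie_bracket X Y = nabla X Y - nabla Y X" by (simp add: torsion_def)
  then have "torsion D X Y p = (D X Y p - D Y X p) - (nabla X Y p - nabla Y X p)"
    by (simp add: torsion_def)
  moreover have "linear_on (tangent_space \<A> p) (\<lambda>x. g p x (Z p))"
    using g in_T[OF XYZ(3)] by (auto simp: bilinear_on_def)
  note diff = linear_on_diff[OF V this]
  ultimately have "lowered_torsion g D X Y Z p =
      (g p (D X Y p) (Z p) - g p (D Y X p) (Z p)) -
      (g p (nabla X Y p) (Z p) - g p (nabla Y X p) (Z p))"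
    using D_in nabla_in V by (simp add: lowered_torsion_def diff subspace_diff)
  then show ?thesis
    using XYZ by (simp add: deform algebra_simps)
qed

lemma almost_contact_space_tangent:
  assumes "almost_contact_B_metric_manifold \<A> n \<phi> \<xi> \<eta> g"
  shows "almost_contact_space (tangent_space \<A> p) (\<phi> p) (\<xi> p) (\<eta> p)"
proof
  have "has_signature (tangent_space \<A> p) (g p) n (n + 1)"
    using assms
    by (simp add: almost_contact_B_metric_manifold_def pseudo_riemannian_metric_def)
  then show "subspace (tangent_space \<A> p)"
    unfolding has_signature_def is_basis_def using subspace_span by metis
qed (use assms in \<open>auto simp: almost_contact_B_metric_manifold_def smooth_endomorphism_def
      smooth_one_form_def vector_fields_def\<close>)

theorem proposition3p7:
  fixes \<A> :: "('m::{t2_space,second_countable_topology}, 'e::euclidean_space) atlas"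
    and n :: nat
    and \<phi> :: "'m endo_field" and \<xi> :: "'m vfield" and \<eta> :: "'m form_field"
    and g :: "'m metric_field" and nabla D :: "'m connection"
  assumes "almost_contact_B_metric_manifold \<A> n \<phi> \<xi> \<eta> g"
    and "levi_civita \<A> g nabla"
    and "in_class_F3_F7 \<A> n \<phi> \<xi> \<eta> g nabla"
    and "phiKT_connection \<A> \<phi> \<xi> \<eta> g nabla D"
  shows "\<forall>p. \<exists>T\<^sub>3 \<in> T3_class (tangent_space \<A> p) (\<phi> p) (\<xi> p).
             \<exists>T\<^sub>6 \<in> T6_class (tangent_space \<A> p) (\<phi> p) (\<xi> p).
             \<exists>T\<^sub>7 \<in> T7_class (tangent_space \<A> p) (\<phi> p) (\<xi> p) (\<eta> p).
             \<exists>T\<^sub>1\<^sub>2 \<in> T12_class (tangent_space \<A> p) (\<phi> p) (\<xi> p) (\<eta> p).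
           tensor_at \<A> (lowered_torsion g D) p
             (\<lambda>x y z. T\<^sub>3 x y z + T\<^sub>6 x y z + T\<^sub>7 x y z + T\<^sub>1\<^sub>2 x y z)"
proof
  fix p
  let ?V = "tangent_space \<A> p"
  let ?F = "fundamental_F \<phi> g nabla"
  interpret almost_contact_space ?V "\<phi> p" "\<xi> p" "\<eta> p"
    using assms(1) by (rule almost_contact_space_tangent)
  obtain F\<^sub>3 F\<^sub>7 where F\<^sub>3: "F\<^sub>3 \<in> F3_class ?V (\<phi> p) (\<xi> p) (\<eta> p)"
    and F\<^sub>7: "F\<^sub>7 \<in> F7_class ?V n (\<phi> p) (\<xi> p) (\<eta> p) (g p)"
    and F: "tensor_at \<A> ?F p (\<lambda>x y z. F\<^sub>3 x y z + F\<^sub>7 x y z)"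
    using assms(3) unfolding in_class_F3_F7_def by blast
  obtain T\<^sub>3 T\<^sub>6 T\<^sub>7 T\<^sub>1\<^sub>2 where
    T: "T\<^sub>3 \<in> T3_class ?V (\<phi> p) (\<xi> p)" "T\<^sub>6 \<in> T6_class ?V (\<phi> p) (\<xi> p)"
      "T\<^sub>7 \<in> T7_class ?V (\<phi> p) (\<xi> p) (\<eta> p)" "T\<^sub>1\<^sub>2 \<in> T12_class ?V (\<phi> p) (\<xi> p) (\<eta> p)"
    and sum: "\<And>x y z. x \<in> ?V \<Longrightarrow> y \<in> ?V \<Longrightarrow> z \<in> ?V \<Longrightarrow>
      - (1 / 2) * cyc (\<lambda>x y z. (F\<^sub>3 x y (\<phi> p z) + F\<^sub>7 x y (\<phi> p z))
        - 3 * \<eta> p x * (F\<^sub>3 y (\<phi> p z) (\<xi> p) + F\<^sub>7 y (\<phi> p z) (\<xi> p))) x y z =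
      T\<^sub>3 x y z + T\<^sub>6 x y z + T\<^sub>7 x y z + T\<^sub>1\<^sub>2 x y z"
    using phiKT_tensor_decomposition[OF F\<^sub>3 F\<^sub>7] by blast
  let ?T = "\<lambda>x y z. T\<^sub>3 x y z + T\<^sub>6 x y z + T\<^sub>7 x y z + T\<^sub>1\<^sub>2 x y z"
  have torsion_tensors:
    "T\<^sub>3 \<in> torsion_tensors ?V" "T\<^sub>6 \<in> torsion_tensors ?V"
    "T\<^sub>7 \<in> torsion_tensors ?V" "T\<^sub>1\<^sub>2 \<in> torsion_tensors ?V"
    using T by (auto simp: T3_class_def T6_class_def T7_class_def T12_class_def)
  have skew: "?T x y z = - ?T y x z" if v: "x \<in> ?V" "y \<in> ?V" "z \<in> ?V" for x y z
  proof -
    have "U x y z = - U y x z" if "U \<in> torsion_tensors ?V" for U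
      using that v unfolding torsion_tensors_def by blast
    from this[OF torsion_tensors(1)] this[OF torsion_tensors(2)] this[OF torsion_tensors(3)]
      this[OF torsion_tensors(4)]
    show ?thesis by simp
  qed
  have in_V: "X p \<in> ?V" if "X \<in> vector_fields \<A>" for X
    using that by (auto simp: vector_fields_def)
  have fields: "\<xi> \<in> vector_fields \<A>" "\<And>X. X \<in> vector_fields \<A> \<Longrightarrow> endo_app \<phi> X \<in> vector_fields \<A>"
    using assms(1) by (auto simp: almost_contact_B_metric_manifold_def smooth_endomorphism_def)
  have phiKT: "phiKT_tensor \<phi> \<xi> \<eta> ?F X Y Z p = ?T (X p) (Y p) (Z p)"
    if "X \<in> vector_fields \<A>" "Y \<in> vector_fields \<A>" "Z \<in> vector_fields \<A>" for X Y Z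
  proof -
    have "?F A B C p = F\<^sub>3 (A p) (B p) (C p) + F\<^sub>7 (A p) (B p) (C p)"
      if "A \<in> vector_fields \<A>" "B \<in> vector_fields \<A>" "C \<in> vector_fields \<A>" for A B C
      using F that by (simp add: tensor_at_def)
    then show ?thesis
      using that fields sum[of "X p" "Y p" "Z p"] in_V
      by (simp add: phiKT_tensor_def cyc_def endo_app_def)
  qed
  have "lowered_torsion g D X Y Z p = ?T (X p) (Y p) (Z p)"
    if XYZ: "X \<in> vector_fields \<A>" "Y \<in> vector_fields \<A>" "Z \<in> vector_fields \<A>" for X Y Z
  proof -
    have "lowered_torsion g D X Y Z p = 1 / 2 *
        (phiKT_tensor \<phi> \<xi> \<eta> ?F X Y Z p - phiKT_tensor \<phi> \<xi> \<eta> ?F Y X Z p)"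
    proof (rule lowered_torsion_of_deformation[OF subspace _ assms(2) _ _ XYZ])
      show "bilinear_on ?V (g p)"
        using assms(1)
        by (simp add: almost_contact_B_metric_manifold_def pseudo_riemannian_metric_def)
      show "linear_connection \<A> D"
        using assms(4) by (simp add: phiKT_connection_def natural_connection_def)
    qed (use assms(4) in \<open>auto simp: phiKT_connection_def\<close>)
    then show ?thesis
      using XYZ skew[of "X p" "Y p" "Z p"] by (simp add: phiKT in_V)
  qed
  moreover have "trilinear_on ?V ?T"
    using torsion_tensors by (intro trilinear_on_add) (auto simp: torsion_tensors_def)
  ultimately have "tensor_at \<A> (lowered_torsion g D) p ?T"
    by (simp add: tensor_at_def)
  with T show "\<exists>T\<^sub>3 \<in> T3_class ?V (\<phi> p) (\<xi> p). \<exists>T\<^sub>6 \<in> T6_class ?V (\<phi> p) (\<xi> p).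
      \<exists>T\<^sub>7 \<in> T7_class ?V (\<phi> p) (\<xi> p) (\<eta> p). \<exists>T\<^sub>1\<^sub>2 \<in> T12_class ?V (\<phi> p) (\<xi> p) (\<eta> p).
      tensor_at \<A> (lowered_torsion g D) p (\<lambda>x y z. T\<^sub>3 x y z + T\<^sub>6 x y z + T\<^sub>7 x y z + T\<^sub>1\<^sub>2 x y z)"
    by blast
qed

end
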